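(* Let $n,m\in\mathbb{N}$. For every finite coloring of $\mathbb{N}$ there are sets $A_1,\dots,A_n\subseteq\mathbb{N}$, each with exactly $m$ elements, such that the set $$\big\{a_1\circ_1 (a_2\circ_2(\cdots\circ_{n-2}(a_{n-1}\circ_{n-1}a_n)\cdots)) : a_i\in A_i \text{ for } 1\le i\le n,\ \circ_i\in\{+,\cdot\}\text{ for } 1\le i\le n-1\big\}$$ is monochromatic.
   Context: $\mathbb{N}=\{1,2,3,\dots\}$. The symbols $\circ_1,\dots,\circ_{n-1}$ range independently over the two operations of addition and multiplication, and expressions are evaluated with the displayed (right-nested) bracketing; for $n=1$ the set is $A_1$. A set is monochromatic if all its elements have the same color. *)

theory Defs
  imports Main
begin

text \<open>The positive integers are the set \<open>{1..}\<close> of type \<^typ>\<open>nat set\<close>.\<close>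

definition finite_coloring :: "(nat \<Rightarrow> 'c) \<Rightarrow> bool" where
  "finite_coloring c \<longleftrightarrow> finite (c ` {1..})"

definition monochromatic :: "(nat \<Rightarrow> 'c) \<Rightarrow> nat set \<Rightarrow> bool" where
  "monochromatic c S \<longleftrightarrow> (\<forall>x\<in>S. \<forall>y\<in>S. c x = c y)"

text \<open>\<open>nested f a i k\<close> is
  \<open>a\<^sub>i \<circ>\<^sub>i (a\<^sub>i\<^sub>+\<^sub>1 \<circ>\<^sub>i\<^sub>+\<^sub>1 (\<cdots> \<circ>\<^sub>i\<^sub>+\<^sub>k\<^sub>-\<^sub>1 a\<^sub>i\<^sub>+\<^sub>k))\<close> with \<open>\<circ>\<^sub>j = f j\<close>:
  it has \<open>k\<close> operations, hence \<open>k + 1\<close> operands.\<close>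

primrec nested :: "(nat \<Rightarrow> nat \<Rightarrow> nat \<Rightarrow> nat) \<Rightarrow> (nat \<Rightarrow> nat) \<Rightarrow> nat \<Rightarrow> nat \<Rightarrow> nat" where
  "nested f a i 0 = a i"
| "nested f a i (Suc k) = f i (a i) (nested f a (Suc i) k)"

definition nested_values :: "nat \<Rightarrow> (nat \<Rightarrow> nat set) \<Rightarrow> nat set" where
  "nested_values n A =
     {nested f a 1 (n - 1) | f a.
        (\<forall>i\<in>{1..n}. a i \<in> A i) \<and> (\<forall>i\<in>{1..n - 1}. f i \<in> {(+), (*)})}"

end

theory Submission
  imports "HOL-Library.Ramsey" "HOL-Library.FuncSet" Defs
begin

text \<open>The innermost operand is \<open>p x\<close> and all others are products of distinct members of a sequence
  \<open>y\<^sub>l = Q\<^sub>l d\<^sub>l\<close>, where \<open>Q\<^sub>l\<close> is divisible by every product of the \<open>y\<^sub>i\<close> with \<open>i < l\<close>. Then each value is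
  \<open>q (x + \<Sum>\<^sub>l k\<^sub>l d\<^sub>l)\<close> with \<open>q\<close> the product of \<open>p\<close> and of the operands that are multiplied, each added
  operand contributing one \<open>l\<close>, its largest index. Van der Waerden's theorem yields \<open>x\<close> and \<open>d\<^sub>l\<close> such that
  the shift by \<open>\<Sum>\<^sub>l k\<^sub>l d\<^sub>l\<close> is invisible to the coloring, provided that \<open>q\<close> has no factor \<open>y\<^sub>l\<close> with
  \<open>k\<^sub>l \<noteq> 0\<close>. It remains to make the color of \<open>q x\<close> independent of the choices. By Ramsey's theorem the color
  depends only on the number of intervals that make up the index set of \<open>q\<close>; and with \<open>p\<close> a union of
  \<open>n\<close> separated intervals and every other operand the union of one gap of \<open>p\<close> and one interval far out,
  that number is always \<open>n\<close>.\<close>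

subsection \<open>Van der Waerden's theorem and an enumerated form of Ramsey's theorem\<close>

text \<open>Transfers van der Waerden's and Ramsey's theorems, stated for colors that are natural
  numbers, to any finite range of colors.\<close>

lemma finite_image_code:
  assumes "finite (f ` A)" "card (f ` A) \<le> r"
  obtains g :: "'a \<Rightarrow> nat"
  where "\<And>x. x \<in> A \<Longrightarrow> g x < r" "\<And>x y. x \<in> A \<Longrightarrow> y \<in> A \<Longrightarrow> g x = g y \<longleftrightarrow> f x = f y"
proof -
  obtain h where h: "bij_betw h (f ` A) {0..<card (f ` A)}"
    using ex_bij_betw_finite_nat[OF assms(1)] by blast
  show thesis
  proof (rule that[of "h \<circ> f"])
    show "(h \<circ> f) x < r" if "x \<in> A" for x
      using bij_betwE[OF h] that assms(2) by fastforce
    show "(h \<circ> f) x = (h \<circ> f) y \<longleftrightarrow> f x = f y" if "x \<in> A" "y \<in> A" for x y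
      using bij_betw_imp_inj_on[OF h] that by (auto simp: inj_on_eq_iff)
  qed
qed

text \<open>The bound \<open>d \<le> V\<close> matters for \<open>K = 0\<close>, where
  \<open>a + K * d \<le> V\<close> does not restrict \<open>d\<close>; the induction on
  \<open>K\<close> needs it to keep the next term in range.\<close>

definition vdw_bound :: "nat \<Rightarrow> nat \<Rightarrow> nat \<Rightarrow> bool" where
  "vdw_bound K r V \<longleftrightarrow> (\<forall>f :: nat \<Rightarrow> nat. (\<forall>i\<le>V. f i < r) \<longrightarrow>
     (\<exists>a d. 0 < d \<and> d \<le> V \<and> a + K * d \<le> V \<and> (\<forall>k\<le>K. f (a + k * d) = f a)))"

lemma vdw_boundD:
  fixes f :: "nat \<Rightarrow> 'b"
  assumes "vdw_bound K r V" "card (f ` {..V}) \<le> r"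
  shows "\<exists>a d. 0 < d \<and> d \<le> V \<and> a + K * d \<le> V \<and> (\<forall>k\<le>K. f (a + k * d) = f a)"
proof -
  obtain g :: "nat \<Rightarrow> nat" where g: "\<And>x. x \<in> {..V} \<Longrightarrow> g x < r"
    "\<And>x y. x \<in> {..V} \<Longrightarrow> y \<in> {..V} \<Longrightarrow> g x = g y \<longleftrightarrow> f x = f y"
    using finite_image_code[of f "{..V}" r] assms(2) by auto
  obtain a d where ad: "0 < d" "d \<le> V" "a + K * d \<le> V" "\<forall>k\<le>K. g (a + k * d) = g a"
    using assms(1) g(1) unfolding vdw_bound_def by (metis atMost_iff)
  have "f (a + k * d) = f a" if "k \<le> K" for k
  proof -
    have "k * d \<le> K * d" using that by simp
    then have "a + k * d \<le> V" "a \<le> V" using ad by linarith+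
    then show ?thesis using g(2)[of "a + k * d" a] ad(4) that by simp
  qed
  with ad show ?thesis by blast
qed

text \<open>In the color-focusing argument the set \<open>S\<close> collects the colors of the progressions of length
  \<open>K + 1\<close> whose next term is the common focus \<open>F\<close>.\<close>

lemma vdw_focus:
  assumes vdw: "\<And>r. \<exists>V. vdw_bound K r V"
  shows "\<exists>V. \<forall>f :: nat \<Rightarrow> nat. (\<forall>i\<le>V. f i < r) \<longrightarrow>
     (\<exists>a d. 0 < d \<and> a + Suc K * d \<le> V \<and> (\<forall>k\<le>Suc K. f (a + k * d) = f a)) \<or>
     (\<exists>F S. F \<le> V \<and> S \<subseteq> {..<r} \<and> card S = s \<and>
        (\<forall>\<gamma>\<in>S. \<exists>a d. 0 < d \<and> a + Suc K * d = F \<and> (\<forall>k\<le>K. f (a + k * d) = \<gamma>)))"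
proof (induction s)
  case 0
  show ?case by (rule exI[of _ 0]) (auto intro!: exI[of _ "{}"])
next
  case (Suc s)
  then obtain V where V: "\<And>f :: nat \<Rightarrow> nat. (\<forall>i\<le>V. f i < r) \<Longrightarrow>
     (\<exists>a d. 0 < d \<and> a + Suc K * d \<le> V \<and> (\<forall>k\<le>Suc K. f (a + k * d) = f a)) \<or>
     (\<exists>F S. F \<le> V \<and> S \<subseteq> {..<r} \<and> card S = s \<and>
        (\<forall>\<gamma>\<in>S. \<exists>a d. 0 < d \<and> a + Suc K * d = F \<and> (\<forall>k\<le>K. f (a + k * d) = \<gamma>)))"
    by blast
  define M where "M = Suc V"
  obtain V' where V': "vdw_bound K (r ^ M) V'" using vdw by blast
  \<comment> \<open>Blocks of length \<open>M\<close> have at most \<open>r ^ M\<close> color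
    patterns. The progression of blocks stays below \<open>V'\<close>, and one more step
    \<open>D \<le> V'\<close> reaches at most block \<open>2 * V'\<close>.\<close>
  define U where "U = (2 * V' + 1) * M"
  show ?case
  proof (intro exI[of _ U] allI impI)
    fix f :: "nat \<Rightarrow> nat"
    assume f: "\<forall>i\<le>U. f i < r"
    have inU: "b * M + i \<le> U" if "b \<le> 2 * V'" "i \<le> V" for b i
    proof -
      have "b * M + i \<le> b * M + M" using that by (simp add: M_def)
      also have "\<dots> \<le> (2 * V' + 1) * M" using mult_le_mono1[of "Suc b" "2 * V' + 1" M] that by simp
      finally show ?thesis by (simp add: U_def)
    qed
    define g where "g b = restrict (\<lambda>i. f (b * M + i)) {..<M}" for b
    have "g ` {..V'} \<subseteq> {..<M} \<rightarrow>\<^sub>E {..<r}"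
      using f inU by (intro image_subsetI) (simp add: g_def M_def less_Suc_eq_le)
    then have "card (g ` {..V'}) \<le> card ({..<M} \<rightarrow>\<^sub>E {..<r})"
      by (intro card_mono finite_PiE) auto
    then have "card (g ` {..V'}) \<le> r ^ M"
      by (simp add: card_funcsetE)
    then obtain b D where bD: "0 < D" "D \<le> V'" "b + K * D \<le> V'" "\<forall>k\<le>K. g (b + k * D) = g b"
      using vdw_boundD[OF V', of g] by blast
    have blk: "f ((b + k * D) * M + i) = f (b * M + i)" if "k \<le> K" "i \<le> V" for k i
    proof -
      have "g (b + k * D) i = g b i" using bD that by simp
      then show ?thesis using that by (simp add: g_def M_def)
    qed
    have top: "b + Suc K * D \<le> 2 * V'" using bD by simp
    have "\<forall>i\<le>V. f (b * M + i) < r" using f inU[of b] bD by simp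
    from V[of "\<lambda>i. f (b * M + i)", OF this]
    show "(\<exists>a d. 0 < d \<and> a + Suc K * d \<le> U \<and> (\<forall>k\<le>Suc K. f (a + k * d) = f a)) \<or>
     (\<exists>F S. F \<le> U \<and> S \<subseteq> {..<r} \<and> card S = Suc s \<and>
        (\<forall>\<gamma>\<in>S. \<exists>a d. 0 < d \<and> a + Suc K * d = F \<and> (\<forall>k\<le>K. f (a + k * d) = \<gamma>)))"
    proof (elim disjE exE conjE)
      fix a d
      assume ad: "0 < d" "a + Suc K * d \<le> V" "\<forall>k\<le>Suc K. f (b * M + (a + k * d)) = f (b * M + a)"
      have "b * M + (a + Suc K * d) \<le> U" using inU[of b] ad bD by simp
      then show ?thesis
        using ad by (intro disjI1 exI[of _ "b * M + a"] exI[of _ d]) (simp add: algebra_simps)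
    next
      fix F S
      assume F: "F \<le> V" "S \<subseteq> {..<r}" "card S = s"
        and foc: "\<forall>\<gamma>\<in>S. \<exists>a d. 0 < d \<and> a + Suc K * d = F \<and> (\<forall>k\<le>K. f (b * M + (a + k * d)) = \<gamma>)"
      define F' where "F' = (b + Suc K * D) * M + F"
      have F': "F' \<le> U" unfolding F'_def using inU top F by blast
      show ?thesis
      \<comment> \<open>A focus color already in \<open>S\<close> prolongs its progression by the
        focus itself; otherwise the copies of the focus supply a new color.\<close>
      proof (cases "f (b * M + F) \<in> S")
        case True
        then obtain a d where ad: "0 < d" "a + Suc K * d = F" "\<forall>k\<le>K. f (b * M + (a + k * d)) = f (b * M + F)"
          using foc by blast
        have "f (b * M + (a + k * d)) = f (b * M + a)" if "k \<le> Suc K" for k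
          using that ad(3)[rule_format, of 0] ad(2,3) by (cases "k = Suc K") auto
        moreover have "b * M + (a + Suc K * d) \<le> U" using inU[of b F] ad F bD by simp
        ultimately show ?thesis
          using ad by (intro disjI1 exI[of _ "b * M + a"] exI[of _ d]) (simp add: algebra_simps)
      next
        case False
        define S' where "S' = insert (f (b * M + F)) S"
        have fin: "finite S" using F finite_subset by blast
        have "S' \<subseteq> {..<r}" using F f inU[of b F] bD by (auto simp: S'_def)
        moreover have "card S' = Suc s" using False F fin by (simp add: S'_def)
        moreover have "\<exists>a d. 0 < d \<and> a + Suc K * d = F' \<and> (\<forall>k\<le>K. f (a + k * d) = \<gamma>)"
          if "\<gamma> \<in> S'" for \<gamma>
        proof (cases "\<gamma> \<in> S")
          case True
          then obtain a d where ad: "0 < d" "a + Suc K * d = F" "\<forall>k\<le>K. f (b * M + (a + k * d)) = \<gamma>"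
            using foc by blast
          \<comment> \<open>Moving by \<open>d\<close> inside the block and by \<open>D\<close>
            blocks at once leads the old progression to the new focus.\<close>
          have "f (b * M + a + k * (d + D * M)) = \<gamma>" if "k \<le> K" for k
          proof -
            have "k * d \<le> Suc K * d" using that by (intro mult_le_mono1) simp
            then have "a + k * d \<le> V" using ad F by linarith
            then have "f ((b + k * D) * M + (a + k * d)) = \<gamma>"
              using blk[OF that] ad(3) that by simp
            then show ?thesis by (simp add: algebra_simps)
          qed
          moreover have "b * M + a + Suc K * (d + D * M) = F'"
            using ad(2) by (simp add: F'_def algebra_simps)
          moreover have "0 < d + D * M" using ad by simp
          ultimately show ?thesis by blast
        next
          case False
          then have \<gamma>: "\<gamma> = f (b * M + F)" using that by (simp add: S'_def)
          have "f (b * M + F + k * (D * M)) = \<gamma>" if "k \<le> K" for k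
            using blk[OF that F(1)] \<gamma> by (simp add: algebra_simps)
          moreover have "b * M + F + Suc K * (D * M) = F'"
            by (simp add: F'_def algebra_simps)
          moreover have "0 < D * M" using bD by (simp add: M_def)
          ultimately show ?thesis by blast
        qed
        ultimately show ?thesis using F' by blast
      qed
    qed
  qed
qed

text \<open>Ask for \<open>r + 1\<close> focused colors: only \<open>r\<close> exist, so the
  focusing alternative fails and the longer progression remains.\<close>

theorem van_der_Waerden: "\<exists>V. vdw_bound K r V"
proof (induction K arbitrary: r)
  case 0
  show ?case by (rule exI[of _ 1]) (auto simp: vdw_bound_def)
next
  case (Suc K)
  obtain V where V: "\<And>f :: nat \<Rightarrow> nat. (\<forall>i\<le>V. f i < r) \<Longrightarrow>
     (\<exists>a d. 0 < d \<and> a + Suc K * d \<le> V \<and> (\<forall>k\<le>Suc K. f (a + k * d) = f a)) \<or>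
     (\<exists>F S. F \<le> V \<and> S \<subseteq> {..<r} \<and> card S = Suc r \<and>
        (\<forall>\<gamma>\<in>S. \<exists>a d. 0 < d \<and> a + Suc K * d = F \<and> (\<forall>k\<le>K. f (a + k * d) = \<gamma>)))"
    using vdw_focus[OF Suc, of r "Suc r"] by blast
  have "vdw_bound (Suc K) r V"
    unfolding vdw_bound_def
  proof (intro allI impI)
    fix f :: "nat \<Rightarrow> nat"
    assume "\<forall>i\<le>V. f i < r"
    moreover have "\<not> (S \<subseteq> {..<r} \<and> card S = Suc r)" for S
      using card_mono[of "{..<r}" S] by auto
    ultimately obtain a d where ad: "0 < d" "a + Suc K * d \<le> V" "\<forall>k\<le>Suc K. f (a + k * d) = f a"
      using V[of f] by blast
    moreover have "d \<le> V" using ad(2) by simp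
    ultimately show "\<exists>a d. 0 < d \<and> d \<le> V \<and> a + Suc K * d \<le> V \<and> (\<forall>k\<le>Suc K. f (a + k * d) = f a)"
      by blast
  qed
  then show ?case by blast
qed

text \<open>\<open>N\<close> must be uniform in \<open>f\<close>, because the coloring of index sets
  is defined only after the progressions, whose number depends on \<open>N\<close>. The increasing
  enumeration provides ordered interval endpoints.\<close>

lemma Ramsey_enumerated:
  "\<exists>N. \<forall>f :: nat set \<Rightarrow> nat. (\<forall>Z. f Z < r) \<longrightarrow>
     (\<exists>e :: nat \<Rightarrow> nat. strict_mono_on {..<M} e \<and> (\<forall>i<M. e i < N) \<and>
        (\<exists>\<gamma>. \<forall>Z\<subseteq>e ` {..<M}. card Z = s \<longrightarrow> f Z = \<gamma>))"
proof -
  obtain N :: nat where N: "partn_lst {..<N} (replicate r M) s"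
    using ramsey_full by blast
  show ?thesis
  proof (intro exI[of _ N] allI impI)
    fix f :: "nat set \<Rightarrow> nat"
    assume "\<forall>Z. f Z < r"
    then have "f \<in> nsets {..<N} s \<rightarrow> {..<length (replicate r M)}" by simp
    then obtain \<gamma> where \<gamma>: "\<gamma> < r" "Ramsey.monochromatic {..<N} (replicate r M ! \<gamma>) s f \<gamma>"
      using N unfolding partn_lst_def by (metis length_replicate)
    then obtain H where H: "H \<in> nsets {..<N} M" "f ` nsets H s \<subseteq> {\<gamma>}"
      unfolding Ramsey.monochromatic_def by auto
    have HN: "H \<subseteq> {..<N}" "finite H" "card H = M" using H(1) by (auto simp: nsets_def)
    define e where "e i = sorted_list_of_set H ! i" for i
    have mono: "strict_mono_on {..<M} e"
      using sorted_wrt_nth_less[OF strict_sorted_list_of_set[of H]] HN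
      by (auto simp: strict_mono_on_def e_def)
    have eH: "e i \<in> H" if "i < M" for i
      using nth_mem[of i "sorted_list_of_set H"] that HN by (simp add: e_def)
    have "f Z = \<gamma>" if "Z \<subseteq> e ` {..<M}" "card Z = s" for Z
    proof -
      have "Z \<in> nsets H s"
        using eH that finite_subset[OF that(1)] by (auto simp: nsets_def)
      then show ?thesis using H(2) by blast
    qed
    then show "\<exists>e :: nat \<Rightarrow> nat. strict_mono_on {..<M} e \<and> (\<forall>i<M. e i < N) \<and>
        (\<exists>\<gamma>. \<forall>Z\<subseteq>e ` {..<M}. card Z = s \<longrightarrow> f Z = \<gamma>)"
      using mono eH HN by blast
  qed
qed

subsection \<open>Shifts that preserve colors\<close>

text \<open>The pairs \<open>(a j, d j)\<close> are chosen for \<open>j = N - 1, \<dots>, 0\<close>. The number of colors needed at step \<open>j\<close>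
  depends only on the number of late words \<open>E\<close>, not on their values, so all \<open>V j\<close> can be fixed in
  advance, in increasing order of \<open>j\<close>; the quantifiers over \<open>X\<close> and \<open>q\<close> anticipate every possible
  choice at the smaller indices.\<close>

lemma late_choice:
  fixes c :: "nat \<Rightarrow> 'c" and B H K Q V :: "nat \<Rightarrow> nat"
  assumes fin: "finite (range c)"
    and vdw: "\<And>j. vdw_bound (K j) (card (range c) ^ (Suc (B j) * Suc (H j) * 2 ^ N)) (V j)"
  defines "good \<equiv> \<lambda>a d j. 0 < d j \<and> a j + K j * d j \<le> V j \<and> d j \<le> V j \<and>
     (\<forall>k\<le>K j. \<forall>X\<le>B j. \<forall>q\<le>H j. \<forall>E\<subseteq>{Suc j..<N}.
        c (q * (\<Prod>l\<in>E. Q l * d l) * (X + (a j + k * d j) + (\<Sum>l\<in>{Suc j..<N}. a l))) =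
        c (q * (\<Prod>l\<in>E. Q l * d l) * (X + a j + (\<Sum>l\<in>{Suc j..<N}. a l))))"
  shows "\<exists>a d. \<forall>j<N. good a d j"
proof -
  \<comment> \<open>\<open>good a d j\<close> reads only indices from \<open>j\<close> on, so later
    choices at smaller indices do not disturb it.\<close>
  have cong: "good a d j \<longleftrightarrow> good a' d' j" if "\<And>l. j \<le> l \<Longrightarrow> a l = a' l \<and> d l = d' l" for a d a' d' j
  proof -
    have "(\<Prod>l\<in>E. Q l * d l) = (\<Prod>l\<in>E. Q l * d' l)" if "E \<subseteq> {Suc j..<N}" for E
      using that \<open>\<And>l. j \<le> l \<Longrightarrow> a l = a' l \<and> d l = d' l\<close> by (intro prod.cong) auto
    moreover have "(\<Sum>l\<in>{Suc j..<N}. a l) = (\<Sum>l\<in>{Suc j..<N}. a' l)"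
      using that by (intro sum.cong) auto
    ultimately show ?thesis using that[of j] by (simp add: good_def)
  qed
  have "\<exists>a d. \<forall>j<N. N \<le> j + n \<longrightarrow> good a d j" for n
  proof (induction n)
    case 0
    show ?case by simp
  next
    case (Suc n)
    then obtain a d where ad: "\<And>j. j < N \<Longrightarrow> N \<le> j + n \<Longrightarrow> good a d j" by blast
    show ?case
    proof (cases "n < N")
      case False
      then show ?thesis using ad by (metis linorder_not_less trans_le_add2)
    next
      case True
      define j where "j = N - Suc n"
      define idx where "idx = {..B j} \<times> {..H j} \<times> Pow {Suc j..<N}"
      \<comment> \<open>The color of \<open>i\<close> is the whole table of colors over
        \<open>idx\<close>, so one progression serves all \<open>X\<close>, \<open>q\<close> and
        \<open>E\<close> simultaneously.\<close>
      define f where "f i = restrict (\<lambda>(X, q, E).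
        c (q * (\<Prod>l\<in>E. Q l * d l) * (X + i + (\<Sum>l\<in>{Suc j..<N}. a l)))) idx" for i
      have finidx: "finite idx" by (simp add: idx_def)
      have "card idx = Suc (B j) * Suc (H j) * 2 ^ (N - Suc j)"
        by (simp add: idx_def card_cartesian_product card_Pow algebra_simps)
      then have card_idx: "card idx \<le> Suc (B j) * Suc (H j) * 2 ^ N"
        by (simp only:) (intro mult_le_mono2 power_increasing; simp)
      have range: "f ` {..V j} \<subseteq> idx \<rightarrow>\<^sub>E range c"
        by (auto simp: f_def split: prod.splits)
      have "card (f ` {..V j}) \<le> card (idx \<rightarrow>\<^sub>E range c)"
        using finite_PiE[OF finidx] fin by (intro card_mono range) simp
      also have "\<dots> = card (range c) ^ card idx"
        by (rule card_funcsetE[OF finidx])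
      also have "\<dots> \<le> card (range c) ^ (Suc (B j) * Suc (H j) * 2 ^ N)"
        using fin by (intro power_increasing card_idx) (simp add: Suc_le_eq card_gt_0_iff)
      finally have "card (f ` {..V j}) \<le> card (range c) ^ (Suc (B j) * Suc (H j) * 2 ^ N)" .
      from vdw_boundD[OF vdw this] obtain a' d' where a'd': "0 < d'" "d' \<le> V j" "a' + K j * d' \<le> V j"
        "\<And>k. k \<le> K j \<Longrightarrow> f (a' + k * d') = f a'" by blast
      have "good (a(j := a')) (d(j := d')) j"
        unfolding good_def
      proof (intro conjI allI impI)
        fix k X q E
        assume h: "k \<le> K j" "X \<le> B j" "q \<le> H j" "E \<subseteq> {Suc j..<N}"
        have "f (a' + k * d') (X, q, E) = f a' (X, q, E)" using a'd' h by simp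
        moreover have "(\<Prod>l\<in>E. Q l * (d(j := d')) l) = (\<Prod>l\<in>E. Q l * d l)"
          using h by (intro prod.cong) auto
        moreover have "(\<Sum>l\<in>{Suc j..<N}. (a(j := a')) l) = (\<Sum>l\<in>{Suc j..<N}. a l)"
          by (intro sum.cong) auto
        ultimately show "c (q * (\<Prod>l\<in>E. Q l * (d(j := d')) l) *
             (X + ((a(j := a')) j + k * (d(j := d')) j) + (\<Sum>l\<in>{Suc j..<N}. (a(j := a')) l))) =
           c (q * (\<Prod>l\<in>E. Q l * (d(j := d')) l) *
             (X + (a(j := a')) j + (\<Sum>l\<in>{Suc j..<N}. (a(j := a')) l)))"
          using h by (simp add: f_def idx_def)
      qed (use a'd' in simp_all)
      moreover have "good (a(j := a')) (d(j := d')) i" if "i < N" "N \<le> i + n" for i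
      proof -
        have "i \<noteq> j" "i \<le> l \<Longrightarrow> l \<noteq> j" for l using that True by (auto simp: j_def)
        then have "good (a(j := a')) (d(j := d')) i \<longleftrightarrow> good a d i" by (intro cong) auto
        then show ?thesis using ad[OF that] by blast
      qed
      ultimately have "\<forall>i<N. N \<le> i + Suc n \<longrightarrow> good (a(j := a')) (d(j := d')) i"
        by (metis True add_Suc_right diff_add_inverse2 j_def le_antisym not_less_eq_eq)
      then show ?thesis by blast
    qed
  qed
  from this[of N] show ?thesis by simp
qed

text \<open>Divisibility of \<open>Q l\<close> lets a product of earlier words be factored out of an
  added operand; the lower bound on \<open>K l\<close> leaves room for the resulting
  coefficient.\<close>

lemma generic_progressions:
  fixes c :: "nat \<Rightarrow> 'c" and m N :: nat
  assumes fin: "finite (range c)"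
  obtains a d Q K :: "nat \<Rightarrow> nat" where
    "\<And>l. l < N \<Longrightarrow> 0 < d l"
    "\<And>l. 2 \<le> Q l"
    "\<And>l. m \<le> K l"
    "\<And>l U. l < N \<Longrightarrow> U \<subseteq> {..<l} \<Longrightarrow> (\<Prod>i\<in>U. Q i * d i) dvd Q l"
    "\<And>l U. l < N \<Longrightarrow> U \<subseteq> {..<l} \<Longrightarrow> Q l * (\<Prod>i\<in>U. Q i * d i) \<le> K l"
    "\<And>U \<kappa>. U \<subseteq> {..<N} \<Longrightarrow> (\<And>l. l < N \<Longrightarrow> \<kappa> l \<le> K l) \<Longrightarrow> (\<And>l. l \<in> U \<Longrightarrow> \<kappa> l = 0) \<Longrightarrow>
       c ((\<Prod>i\<in>U. Q i * d i) * (\<Sum>l<N. a l + \<kappa> l * d l)) = c ((\<Prod>i\<in>U. Q i * d i) * (\<Sum>l<N. a l))"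
proof -
  obtain v where v: "\<And>K r. vdw_bound K r (v K r)" using van_der_Waerden by metis
  \<comment> \<open>The factorial is divisible by every positive number up to \<open>h\<close>; the
    factor 2 ensures \<open>2 \<le> Q l\<close>.\<close>
  define Qf :: "nat \<Rightarrow> nat" where "Qf h = 2 * fact h" for h
  define Kf where "Kf h = Qf h * h + m" for h
  define Vf where "Vf b h = v (Kf h) (card (range c) ^ (Suc b * Suc h * 2 ^ N))" for b h
  \<comment> \<open>The first component sums the bounds on earlier terms, the second multiplies the
    bounds on earlier words; 0 and 1 are the empty sum and product.\<close>
  define bh where "bh = rec_nat (0, 1) (\<lambda>_ (b, h). (b + Vf b h, h * (Qf h * Vf b h)))"
  define B where "B j = fst (bh j)" for j
  define H where "H j = snd (bh j)" for j
  define Q where "Q j = Qf (H j)" for j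
  define K where "K j = Kf (H j)" for j
  define V where "V j = Vf (B j) (H j)" for j
  have B_Suc: "B (Suc j) = B j + V j" and H_Suc: "H (Suc j) = H j * (Q j * V j)" for j
    by (simp_all add: B_def H_def V_def Q_def bh_def split: prod.splits)
  have B: "B j = (\<Sum>l<j. V l)" for j
    by (induction j) (simp_all add: B_Suc, simp add: B_def bh_def)
  have H: "H j = (\<Prod>l<j. Q l * V l)" for j
    by (induction j) (simp_all add: H_Suc, simp add: H_def bh_def)
  have vdw: "vdw_bound (K j) (card (range c) ^ (Suc (B j) * Suc (H j) * 2 ^ N)) (V j)" for j
    unfolding V_def Vf_def K_def by (rule v)
  obtain a d where good: "\<And>j. j < N \<Longrightarrow> 0 < d j \<and> a j + K j * d j \<le> V j \<and> d j \<le> V j \<and>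
     (\<forall>k\<le>K j. \<forall>X\<le>B j. \<forall>q\<le>H j. \<forall>E\<subseteq>{Suc j..<N}.
        c (q * (\<Prod>l\<in>E. Q l * d l) * (X + (a j + k * d j) + (\<Sum>l\<in>{Suc j..<N}. a l))) =
        c (q * (\<Prod>l\<in>E. Q l * d l) * (X + a j + (\<Sum>l\<in>{Suc j..<N}. a l))))"
    using late_choice[OF fin, of K B H N V Q, OF vdw] by auto
  then have d: "0 < d j" and adV: "a j + K j * d j \<le> V j" and dV: "d j \<le> V j" if "j < N" for j
    using that by simp_all
  have inv: "c (q * (\<Prod>l\<in>E. Q l * d l) * (X + (a j + k * d j) + (\<Sum>l\<in>{Suc j..<N}. a l))) =
      c (q * (\<Prod>l\<in>E. Q l * d l) * (X + a j + (\<Sum>l\<in>{Suc j..<N}. a l)))"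
    if "j < N" "k \<le> K j" "X \<le> B j" "q \<le> H j" "E \<subseteq> {Suc j..<N}" for j k X q E
    using good[OF that(1)] that by simp
  have Q2: "2 \<le> Q l" for l
    using fact_ge_1[of "H l", where 'a = nat] by (simp add: Q_def Qf_def)
  define Y where "Y U = (\<Prod>i\<in>U. Q i * d i)" for U
  have Ypos: "0 < Y U" if "U \<subseteq> {..<N}" for U
    unfolding Y_def
  proof (rule prod_pos)
    show "0 < Q i * d i" if "i \<in> U" for i
      using d[of i] Q2[of i] \<open>U \<subseteq> {..<N}\<close> that by (intro mult_pos_pos) auto
  qed
  have YH: "Y U \<le> H l" if "l \<le> N" "U \<subseteq> {..<l}" for l U
  proof -
    have "Y U dvd Y {..<l}" unfolding Y_def using that by (intro prod_dvd_prod_subset) auto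
    then have "Y U \<le> Y {..<l}" using Ypos[of "{..<l}"] that by (intro dvd_imp_le) auto
    also have "\<dots> \<le> H l" unfolding Y_def H using that dV by (intro prod_mono) auto
    finally show ?thesis .
  qed
  have Ydvd: "Y U dvd Q l" if "l < N" "U \<subseteq> {..<l}" for l U
  proof -
    have "U \<subseteq> {..<N}" using that by auto
    then have "Y U dvd fact (H l)"
      using YH[of l U] Ypos[of U] that by (intro dvd_fact) auto
    then show ?thesis by (simp add: Q_def Qf_def)
  qed
  have YK: "Q l * Y U \<le> K l" if "l < N" "U \<subseteq> {..<l}" for l U
    using YH[of l U] that by (simp add: K_def Kf_def Q_def trans_le_add1)
  have inv': "c (Y U * (\<Sum>l<N. a l + \<kappa> l * d l)) = c (Y U * (\<Sum>l<N. a l))"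
    if U: "U \<subseteq> {..<N}" and \<kappa>: "\<And>l. l < N \<Longrightarrow> \<kappa> l \<le> K l" "\<And>l. l \<in> U \<Longrightarrow> \<kappa> l = 0" for U \<kappa>
  proof -
    \<comment> \<open>\<open>s t\<close> has only the first \<open>t\<close> shifts applied; they
      are removed one at a time.\<close>
    define s where "s t = (\<Sum>l<t. a l + \<kappa> l * d l) + (\<Sum>l\<in>{t..<N}. a l)" for t
    have "c (Y U * s t) = c (Y U * (\<Sum>l<N. a l))" if "t \<le> N" for t
      using that
    proof (induction t)
      case 0
      show ?case by (simp add: s_def atLeast0LessThan)
    next
      case (Suc t)
      have split: "(\<Sum>l\<in>{t..<N}. a l) = a t + (\<Sum>l\<in>{Suc t..<N}. a l)"
        using Suc.prems by (simp add: sum.atLeast_Suc_lessThan)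
      have "c (Y U * s (Suc t)) = c (Y U * s t)"
      proof (cases "t \<in> U")
        case True
        then show ?thesis by (simp add: s_def split \<kappa>(2) add.assoc)
      next
        case False
        \<comment> \<open>The words of \<open>U\<close> before \<open>t\<close> form the
          \<open>q\<close> and those after \<open>t\<close> the \<open>E\<close> of the invariance
          at \<open>t\<close>.\<close>
        define X where "X = (\<Sum>l<t. a l + \<kappa> l * d l)"
        have XB: "X \<le> B t"
          unfolding X_def B
        proof (rule sum_mono)
          fix l assume "l \<in> {..<t}"
          then have "l < N" using Suc.prems by simp
          moreover have "\<kappa> l * d l \<le> K l * d l" using \<kappa>(1)[OF \<open>l < N\<close>] by simp
          ultimately show "a l + \<kappa> l * d l \<le> V l" using adV[of l] by linarith
        qed
        have "x < t \<or> x \<in> {Suc t..<N}" if "x \<in> U" for x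
          using that U False by (cases x t rule: linorder_cases) auto
        then have "U = (U \<inter> {..<t}) \<union> (U \<inter> {Suc t..<N})" by blast
        then have "Y U = Y ((U \<inter> {..<t}) \<union> (U \<inter> {Suc t..<N}))" by simp
        then have "Y U = Y (U \<inter> {..<t}) * (\<Prod>l\<in>U \<inter> {Suc t..<N}. Q l * d l)"
          unfolding Y_def by (subst (asm) prod.union_disjoint) auto
        moreover have "Y (U \<inter> {..<t}) \<le> H t" using Suc.prems by (intro YH) auto
        moreover have "s (Suc t) = X + (a t + \<kappa> t * d t) + (\<Sum>l\<in>{Suc t..<N}. a l)"
          "s t = X + a t + (\<Sum>l\<in>{Suc t..<N}. a l)"
          by (simp_all add: s_def X_def split)
        ultimately show ?thesis
          using inv[of t "\<kappa> t" X "Y (U \<inter> {..<t})" "U \<inter> {Suc t..<N}"] \<kappa>(1)[of t] Suc.prems XB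
          by simp
      qed
      then show ?case using Suc by simp
    qed
    from this[of N] show ?thesis by (simp add: s_def)
  qed
  show thesis
  proof (rule that)
    show "0 < d l" if "l < N" for l using that by (rule d)
    show "2 \<le> Q l" for l by (rule Q2)
    show "m \<le> K l" for l by (simp add: K_def Kf_def)
    show "(\<Prod>i\<in>U. Q i * d i) dvd Q l" if "l < N" "U \<subseteq> {..<l}" for l U
      using Ydvd[OF that] by (simp only: Y_def)
    show "Q l * (\<Prod>i\<in>U. Q i * d i) \<le> K l" if "l < N" "U \<subseteq> {..<l}" for l U
      using YK[OF that] by (simp only: Y_def)
    show "c ((\<Prod>i\<in>U. Q i * d i) * (\<Sum>l<N. a l + \<kappa> l * d l)) = c ((\<Prod>i\<in>U. Q i * d i) * (\<Sum>l<N. a l))"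
      if "U \<subseteq> {..<N}" "\<And>l. l < N \<Longrightarrow> \<kappa> l \<le> K l" "\<And>l. l \<in> U \<Longrightarrow> \<kappa> l = 0" for U \<kappa>
      using inv'[OF that] by (simp only: Y_def)
  qed
qed

subsection \<open>Operands built from unions of intervals\<close>

text \<open>For \<open>z\<^sub>0 < z\<^sub>1 < \<dots> < z\<^sub>2\<^sub>n\<^sub>-\<^sub>1\<close> this is the union of the \<open>n\<close> separated intervals
  \<open>[z\<^sub>0, z\<^sub>1), [z\<^sub>2, z\<^sub>3), \<dots>\<close>.\<close>

definition interval_union :: "nat set \<Rightarrow> nat set" where
  "interval_union Z = {l. odd (card {z \<in> Z. z \<le> l})}"

text \<open>The two new endpoints flip the parity of the count exactly where only \<open>u\<close>
  is counted.\<close>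

lemma interval_union_insert2:
  assumes "finite Z" "u \<notin> Z" "v \<notin> Z" "u < v"
  shows "interval_union (insert u (insert v Z)) = sym_diff (interval_union Z) {u..<v}"
proof -
  have "l \<in> interval_union (insert u (insert v Z)) \<longleftrightarrow>
      (l \<in> interval_union Z) \<noteq> (l \<in> {u..<v})" for l
  proof -
    have "{z \<in> insert u (insert v Z). z \<le> l} =
        {z \<in> Z. z \<le> l} \<union> (if u \<le> l then {u} else {}) \<union> (if v \<le> l then {v} else {})"
      by auto
    then show ?thesis using assms by (auto simp: interval_union_def card_insert_if)
  qed
  then show ?thesis by blast
qed

lemma interval_union_below:
  assumes "finite Z" "even (card Z)" "\<And>z. z \<in> Z \<Longrightarrow> z \<le> b"
  shows "interval_union Z \<subseteq> {..<b}"
proof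
  fix l assume "l \<in> interval_union Z"
  moreover have "{z \<in> Z. z \<le> l} = Z" if "b \<le> l" using assms(3) that by force
  ultimately show "l \<in> {..<b}" using assms(2) by (force simp: interval_union_def)
qed

section \<open>Endpoints, operands and normal forms of values\<close>

text \<open>The first \<open>2 * n\<close> indices listed by \<open>e\<close> bound the intervals of
  \<open>p\<close>; then come blocks of \<open>m + 1\<close> indices for the far intervals of the
  other operands. Index \<open>top\<close>, beyond all intervals, carries the variation of the
  innermost operand.\<close>

locale generic_words =
  fixes n m top :: nat and x d Q K e :: "nat \<Rightarrow> nat"
  assumes n: "1 \<le> n"
    and d_pos: "l \<le> top \<Longrightarrow> 0 < d l"
    and Q_ge: "2 \<le> Q l"
    and K_ge: "m \<le> K l"
    and Q_dvd: "l \<le> top \<Longrightarrow> U \<subseteq> {..<l} \<Longrightarrow> (\<Prod>i\<in>U. Q i * d i) dvd Q l"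
    and K_bound: "l \<le> top \<Longrightarrow> U \<subseteq> {..<l} \<Longrightarrow> Q l * (\<Prod>i\<in>U. Q i * d i) \<le> K l"
    and e_mono: "strict_mono_on {..<2 * n + n * Suc m} e"
    and e_top: "i < 2 * n + n * Suc m \<Longrightarrow> e i \<le> top"
begin

definition Y :: "nat set \<Rightarrow> nat" where
  "Y U = (\<Prod>i\<in>U. Q i * d i)"

definition fresh :: "nat \<Rightarrow> nat" where
  "fresh k = 2 * n + k * Suc m"

text \<open>Counting from 0, the intervals of \<open>p\<close> are
  \<open>[e (2 * j), e (2 * j + 1))\<close>, so this separates intervals \<open>k\<close> and
  \<open>k + 1\<close>.\<close>

definition gap :: "nat \<Rightarrow> nat set" where
  "gap k = {e (2 * k + 1)..<e (2 * k + 2)}"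

definition C :: "nat \<Rightarrow> nat \<Rightarrow> nat set" where
  "C k t = gap k \<union> {e (fresh k)..<e (fresh k + t)}"

text \<open>Gaps are assigned from the inside outwards: the operand next to the innermost one uses
  \<open>C 0\<close>.\<close>

definition A :: "nat \<Rightarrow> nat set" where
  "A i = (if i = n then (\<lambda>t. Y (interval_union (e ` {..<2 * n})) * ((\<Sum>l\<le>top. x l) + t * d top)) ` {1..m}
          else (\<lambda>t. Y (C (n - Suc i) t)) ` {1..m})"

definition normal_form :: "nat set \<Rightarrow> (nat \<Rightarrow> nat) \<Rightarrow> nat" where
  "normal_form Z \<kappa> = Y (interval_union Z) * (\<Sum>l\<le>top. x l + \<kappa> l * d l)"

text \<open>After \<open>k\<close> operations the operands still to come fill the gaps \<open>gap j\<close> with \<open>j \<ge> k\<close>. Multiplication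
  by \<open>Y (C k t)\<close> trades the gap \<open>gap k\<close> for a new interval at the far end, which keeps the number of
  intervals, while addition changes \<open>\<kappa>\<close> only at an index beyond all intervals.\<close>

definition admissible :: "nat \<Rightarrow> nat set \<Rightarrow> (nat \<Rightarrow> nat) \<Rightarrow> bool" where
  "admissible k Z \<kappa> \<longleftrightarrow> Z \<subseteq> e ` {..<fresh k} \<and> card Z = 2 * n \<and>
     (\<forall>j. k \<le> j \<and> Suc j < n \<longrightarrow>
        e (2 * j + 1) \<in> Z \<and> e (2 * j + 2) \<in> Z \<and> interval_union Z \<inter> gap j = {}) \<and>
     (\<forall>l\<le>top. \<kappa> l \<le> K l) \<and> (\<forall>l\<in>interval_union Z. \<kappa> l = 0) \<and>
     (\<forall>l. \<kappa> l \<noteq> 0 \<longrightarrow> l = top \<or> e (2 * n) \<le> l \<and> l < e (fresh k))"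

section \<open>Order and disjointness of the index intervals\<close>

lemma e_less: "i < j \<Longrightarrow> j < fresh n \<Longrightarrow> e i < e j"
  using strict_mono_onD[OF e_mono, of i j] by (simp add: fresh_def)

lemma e_le: "i \<le> j \<Longrightarrow> j < fresh n \<Longrightarrow> e i \<le> e j"
  using e_less[of i j] by (cases "i = j") auto

lemma e_eq_iff: "i < fresh n \<Longrightarrow> j < fresh n \<Longrightarrow> e i = e j \<longleftrightarrow> i = j"
  using e_less[of i j] e_less[of j i] by (cases i j rule: linorder_cases) auto

lemma e_le_top: "i < fresh n \<Longrightarrow> e i \<le> top"
  using e_top[of i] by (simp add: fresh_def)

lemma fresh_mono: "j \<le> k \<Longrightarrow> fresh j \<le> fresh k"
  unfolding fresh_def by (intro add_left_mono mult_le_mono1)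

lemma fresh_add_less:
  assumes "k < n" "t \<le> m"
  shows "fresh k + t < fresh (Suc k)" "fresh k + t < fresh n"
proof -
  show "fresh k + t < fresh (Suc k)" using assms by (simp add: fresh_def)
  also have "\<dots> \<le> fresh n" using assms by (intro fresh_mono) simp
  finally show "fresh k + t < fresh n" .
qed

lemma twice_n_le_fresh: "2 * n \<le> fresh k"
  by (simp add: fresh_def)

lemma Y_pos:
  assumes "U \<subseteq> {..top}"
  shows "0 < Y U"
  unfolding Y_def
proof (rule prod_pos)
  show "0 < Q i * d i" if "i \<in> U" for i
    using d_pos[of i] Q_ge[of i] assms that by (intro mult_pos_pos) auto
qed

lemma Y_union: "finite U \<Longrightarrow> finite W \<Longrightarrow> U \<inter> W = {} \<Longrightarrow> Y (U \<union> W) = Y U * Y W"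
  unfolding Y_def by (rule prod.union_disjoint)

lemma admissible_interval_union:
  assumes "admissible k Z \<kappa>" "k < n"
  shows "finite Z" "interval_union Z \<subseteq> {..<e (fresh k)}" "interval_union Z \<subseteq> {..<top}"
proof -
  have Z: "Z \<subseteq> e ` {..<fresh k}" "card Z = 2 * n" using assms by (auto simp: admissible_def)
  then show fin: "finite Z" using finite_subset by blast
  have k: "fresh k < fresh n" using fresh_add_less[OF assms(2), of 0] by simp
  have "z \<le> e (fresh k)" if "z \<in> Z" for z
    using that Z(1) e_le[OF _ k] by force
  then show "interval_union Z \<subseteq> {..<e (fresh k)}"
    using Z by (intro interval_union_below fin) auto
  also have "\<dots> \<subseteq> {..<top}" using e_le_top[OF k] by auto
  finally show "interval_union Z \<subseteq> {..<top}" .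
qed

lemma gap_less:
  assumes "Suc j < n" "l \<in> gap j"
  shows "l < e (2 * n)"
proof -
  have "2 * n < fresh n" using n by (simp add: fresh_def)
  then have "e (2 * j + 2) \<le> e (2 * n)" using assms(1) by (intro e_le) auto
  then show ?thesis using assms(2) by (simp add: gap_def)
qed

lemma gap_disjoint:
  assumes "i < j" "Suc j < n"
  shows "gap i \<inter> gap j = {}"
proof -
  have "2 * j + 1 < fresh n" using assms by (simp add: fresh_def)
  then have "e (2 * i + 2) \<le> e (2 * j + 1)" using assms by (intro e_le) auto
  then show ?thesis by (auto simp: gap_def)
qed

section \<open>The effect of one operation\<close>

text \<open>Filling the gap deletes two endpoints and the far interval adds two. No shifted index is
  hit: nonzero \<open>\<kappa>\<close> occur only at \<open>top\<close> or from
  \<open>e (2 * n)\<close> to below \<open>e (fresh k)\<close>, while the gap lies before that range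
  and the far interval between it and \<open>top\<close>.\<close>

lemma normal_form_mult:
  assumes adm: "admissible k Z \<kappa>" and k: "Suc k < n" and t: "1 \<le> t" "t \<le> m"
  shows "\<exists>Z'. admissible (Suc k) Z' \<kappa> \<and> Y (C k t) * normal_form Z \<kappa> = normal_form Z' \<kappa>"
proof -
  define u v where "u = e (fresh k)" and "v = e (fresh k + t)"
  define g h where "g = e (2 * k + 1)" and "h = e (2 * k + 2)"
  have k': "k < n" using k by simp
  have Z: "Z \<subseteq> e ` {..<fresh k}" "card Z = 2 * n" "g \<in> Z" "h \<in> Z" "interval_union Z \<inter> gap k = {}"
    using adm k by (auto simp: admissible_def g_def h_def)
  note fin = admissible_interval_union(1)[OF adm k'] and below = admissible_interval_union(2)[OF adm k']
  have bounds: "2 * n \<le> fresh k" "fresh k + t < fresh n" "fresh k + t < fresh (Suc k)"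
    using twice_n_le_fresh fresh_add_less[OF k' t(2)] by auto
  have uv: "u < v" using t bounds by (auto simp: u_def v_def intro!: e_less)
  have gh: "g < h" using k bounds by (auto simp: g_def h_def intro!: e_less)
  have new: "e i \<notin> Z" if "fresh k \<le> i" "i < fresh n" for i
  proof
    assume "e i \<in> Z"
    then obtain j where "j < fresh k" "e i = e j" using Z(1) by auto
    then show False using that e_eq_iff[of i j] by simp
  qed
  have uvZ: "u \<notin> Z" "v \<notin> Z" using new bounds by (auto simp: u_def v_def)
  define Z0 where "Z0 = Z - {g, h}"
  define Z' where "Z' = insert u (insert v Z0)"
  have fin0: "finite Z0" using fin by (simp add: Z0_def)
  have ZZ0: "Z = insert g (insert h Z0)" using Z by (auto simp: Z0_def)
  have "interval_union Z = sym_diff (interval_union Z0) (gap k)"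
    unfolding gap_def ZZ0 g_def[symmetric] h_def[symmetric]
    by (rule interval_union_insert2[OF fin0 _ _ gh]) (simp_all add: Z0_def)
  with Z(5) have W0: "interval_union Z0 = interval_union Z \<union> gap k" by blast
  have e2n_le_u: "e (2 * n) \<le> u" using bounds by (auto simp: u_def intro: e_le)
  have gapu: "gap j \<inter> {u..<v} = {}" if "Suc j < n" for j
    using gap_less[OF that] e2n_le_u by fastforce
  have "interval_union Z' = sym_diff (interval_union Z0) {u..<v}"
    unfolding Z'_def by (rule interval_union_insert2[OF fin0 _ _ uv]) (use uvZ in \<open>simp_all add: Z0_def\<close>)
  moreover have "interval_union Z0 \<inter> {u..<v} = {}"
    using below gapu[OF k] unfolding W0 u_def by fastforce
  ultimately have "interval_union Z' = interval_union Z0 \<union> {u..<v}" by blast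
  then have W': "interval_union Z' = C k t \<union> interval_union Z"
    unfolding W0 C_def u_def v_def by blast
  have CZ: "C k t \<inter> interval_union Z = {}"
    using Z(5) below unfolding C_def u_def by fastforce
  have "Y (interval_union Z') = Y (C k t) * Y (interval_union Z)"
    unfolding W' using CZ below finite_subset by (intro Y_union) (auto simp: C_def gap_def)
  then have nf: "Y (C k t) * normal_form Z \<kappa> = normal_form Z' \<kappa>"
    by (simp add: normal_form_def)
  have "admissible (Suc k) Z' \<kappa>"
    unfolding admissible_def
  proof (intro conjI allI impI ballI)
    have "Z \<subseteq> e ` {..<fresh (Suc k)}" using Z(1) fresh_mono[of k "Suc k"] by fastforce
    then show "Z' \<subseteq> e ` {..<fresh (Suc k)}"
      using bounds by (auto simp: Z'_def Z0_def u_def v_def)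
    have "card (insert g (insert h Z0)) = card Z0 + 2"
      using gh fin0 by (simp add: card_insert_if) (simp add: Z0_def)
    then have "card Z0 + 2 = 2 * n" using Z(2) ZZ0 by metis
    then show "card Z' = 2 * n"
      using uv uvZ fin0 by (simp add: Z'_def) (simp add: Z0_def)
  next
    fix j assume j: "Suc k \<le> j \<and> Suc j < n"
    then have "e (2 * j + 1) \<in> Z" "e (2 * j + 2) \<in> Z" "interval_union Z \<inter> gap j = {}"
      using adm by (auto simp: admissible_def)
    moreover have "e (2 * j + 1) \<notin> {g, h}" "e (2 * j + 2) \<notin> {g, h}"
      using j bounds by (auto simp: g_def h_def e_eq_iff)
    moreover have "gap k \<inter> gap j = {}" using j by (intro gap_disjoint) auto
    moreover have "gap j \<inter> {u..<v} = {}" using gapu j by blast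
    ultimately show "e (2 * j + 1) \<in> Z'" "e (2 * j + 2) \<in> Z'" "interval_union Z' \<inter> gap j = {}"
      unfolding W' by (auto simp: Z'_def Z0_def C_def u_def v_def)
  next
    fix l assume "l \<le> top"
    then show "\<kappa> l \<le> K l" using adm by (simp add: admissible_def)
  next
    fix l assume l: "l \<in> interval_union Z'"
    show "\<kappa> l = 0"
    proof (cases "l \<in> interval_union Z")
      case True
      then show ?thesis using adm by (simp add: admissible_def)
    next
      case False
      then have "l \<in> C k t" using l W' by blast
      then have "l < e (2 * n) \<or> u \<le> l" "l < v"
        using gap_less[OF k, of l] uv gapu[OF k] e2n_le_u by (fastforce simp: C_def u_def v_def)+
      moreover have "v \<le> top" using bounds by (simp add: v_def e_le_top)
      ultimately have "\<not> (l = top \<or> e (2 * n) \<le> l \<and> l < e (fresh k))" by (auto simp: u_def)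
      then show ?thesis using adm unfolding admissible_def by blast
    qed
  next
    fix l assume "\<kappa> l \<noteq> 0"
    then have "l = top \<or> e (2 * n) \<le> l \<and> l < e (fresh k)" using adm by (simp add: admissible_def)
    moreover have "e (fresh k) < e (fresh (Suc k))"
      using bounds fresh_add_less(2)[OF k, of 0] by (intro e_less) auto
    ultimately show "l = top \<or> e (2 * n) \<le> l \<and> l < e (fresh (Suc k))" by auto
  qed
  with nf show ?thesis by blast
qed


text \<open>Let \<open>l\<close> be the largest index of \<open>C k t\<close>. Since
  \<open>interval_union Z\<close> lies below \<open>l\<close>, its product divides
  \<open>Q l\<close>. Hence the added operand is that product times a multiple of
  \<open>d l\<close>, and only the coefficient at \<open>l\<close> changes.\<close>

lemma normal_form_add:
  assumes adm: "admissible k Z \<kappa>" and k: "Suc k < n" and t: "1 \<le> t" "t \<le> m"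
  shows "\<exists>\<kappa>'. admissible (Suc k) Z \<kappa>' \<and> Y (C k t) + normal_form Z \<kappa> = normal_form Z \<kappa>'"
proof -
  have k': "k < n" using k by simp
  define U where "U = interval_union Z"
  have bounds: "2 * n \<le> fresh k" "fresh k + t < fresh n" "fresh k + t < fresh (Suc k)"
    using twice_n_le_fresh fresh_add_less[OF k' t(2)] by auto
  have uv: "e (fresh k) < e (fresh k + t)" using t bounds by (auto intro!: e_less)
  \<comment> \<open>The far interval is half-open and, as \<open>t \<ge> 1\<close>, nonempty; its
    last index is one below its end.\<close>
  define l where "l = e (fresh k + t) - 1"
  define C' where "C' = C k t - {l}"
  have sl: "e (fresh k) \<le> l" using uv by (simp add: l_def)
  have ltop: "l < top" using e_le_top[OF bounds(2)] uv by (simp add: l_def)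
  have Ul: "U \<subseteq> {..<l}" using admissible_interval_union(2)[OF adm k'] sl by (auto simp: U_def)
  have e2n: "e (2 * n) \<le> e (fresh k)" using bounds by (intro e_le) auto
  have lC: "l \<in> C k t" using uv by (auto simp: C_def l_def)
  have C'l: "C' \<subseteq> {..<l}"
    using gap_less[OF k] e2n sl by (fastforce simp: C'_def C_def l_def)
  have "finite (C k t)" by (simp add: C_def gap_def)
  then have YC: "Y (C k t) = Q l * d l * Y C'"
    using lC by (simp add: Y_def C'_def prod.remove)
  have "Y U dvd Q l" unfolding Y_def using Q_dvd Ul ltop by simp
  then obtain q where q: "Q l = Y U * q" by (rule dvdE)
  have "0 < Y U" using Ul ltop by (intro Y_pos) auto
  then have "q \<le> Q l" using q by simp
  then have "q * Y C' \<le> Q l * Y C'" by simp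
  also have "\<dots> \<le> K l" unfolding Y_def using K_bound C'l ltop by simp
  finally have qK: "q * Y C' \<le> K l" .
  \<comment> \<open>The index \<open>l\<close> is too far out to have been shifted before, so its
    old coefficient is 0.\<close>
  define \<kappa>' where "\<kappa>' = \<kappa>(l := q * Y C')"
  have \<kappa>l: "\<kappa> l = 0" using adm sl ltop by (auto simp: admissible_def)
  have "(\<Sum>i\<le>top. x i + \<kappa>' i * d i) = (\<Sum>i\<le>top. (x i + \<kappa> i * d i) + (if i = l then q * Y C' * d l else 0))"
    using \<kappa>l by (intro sum.cong) (auto simp: \<kappa>'_def)
  also have "\<dots> = (\<Sum>i\<le>top. x i + \<kappa> i * d i) + q * Y C' * d l"
    using ltop by (simp add: sum.distrib)
  finally have "normal_form Z \<kappa>' = Y (C k t) + normal_form Z \<kappa>"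
    unfolding normal_form_def U_def[symmetric] YC q by (simp add: algebra_simps)
  moreover have "admissible (Suc k) Z \<kappa>'"
    unfolding admissible_def
  proof (intro conjI allI impI ballI)
    show "Z \<subseteq> e ` {..<fresh (Suc k)}"
      using adm fresh_mono[of k "Suc k"] by (fastforce simp: admissible_def)
    show "card Z = 2 * n" using adm by (simp add: admissible_def)
  next
    fix j assume "Suc k \<le> j \<and> Suc j < n"
    then show "e (2 * j + 1) \<in> Z" "e (2 * j + 2) \<in> Z" "interval_union Z \<inter> gap j = {}"
      using adm by (auto simp: admissible_def)
  next
    fix i assume "i \<le> top"
    then show "\<kappa>' i \<le> K i" using adm qK by (simp add: admissible_def \<kappa>'_def)
  next
    fix i assume i: "i \<in> interval_union Z"
    then have "i \<noteq> l" using Ul by (auto simp: U_def)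
    then show "\<kappa>' i = 0" using adm i by (simp add: admissible_def \<kappa>'_def)
  next
    fix i assume i: "\<kappa>' i \<noteq> 0"
    have "e (fresh k) < e (fresh k + t)" "e (fresh k + t) \<le> e (fresh (Suc k))"
      using uv bounds fresh_add_less(2)[OF k, of 0] by (auto intro!: e_le)
    moreover have "i = l \<or> i = top \<or> e (2 * n) \<le> i \<and> i < e (fresh k)"
      using adm i by (auto simp: admissible_def \<kappa>'_def split: if_splits)
    ultimately show "i = top \<or> e (2 * n) \<le> i \<and> i < e (fresh (Suc k))"
      using sl e2n by (auto simp: l_def)
  qed
  ultimately show ?thesis by metis
qed

lemma admissible_initial:
  assumes "1 \<le> t" "t \<le> m"
  defines "Z \<equiv> e ` {..<2 * n}" and "\<kappa> \<equiv> (\<lambda>l. if l = top then t else 0)"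
  shows "admissible 0 Z \<kappa>"
    and "Y (interval_union Z) * ((\<Sum>l\<le>top. x l) + t * d top) = normal_form Z \<kappa>"
proof -
  have "(\<Sum>l\<le>top. x l + \<kappa> l * d l) = (\<Sum>l\<le>top. x l + (if l = top then t * d top else 0))"
    by (intro sum.cong) (auto simp: \<kappa>_def)
  then show "Y (interval_union Z) * ((\<Sum>l\<le>top. x l) + t * d top) = normal_form Z \<kappa>"
    by (simp add: normal_form_def sum.distrib)
  have n2: "2 * n < fresh n" using n by (simp add: fresh_def)
  have inj: "inj_on e {..<fresh n}" by (auto simp: inj_on_def e_eq_iff)
  have cardimg: "card (e ` {..<i}) = i" if "i \<le> fresh n" for i
    using card_image[OF inj_on_subset[OF inj, of "{..<i}"]] that by simp
  have "interval_union Z \<subseteq> {..<e (2 * n)}"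
    using cardimg[of "2 * n"] n2 by (intro interval_union_below) (auto simp: Z_def intro!: e_le)
  then have below: "interval_union Z \<subseteq> {..<top}" using e_le_top[OF n2] by auto
  show "admissible 0 Z \<kappa>"
    unfolding admissible_def
  proof (intro conjI allI impI ballI)
    show "Z \<subseteq> e ` {..<fresh 0}" by (simp add: Z_def fresh_def)
    show "card Z = 2 * n" using cardimg[of "2 * n"] n2 by (simp add: Z_def)
  next
    fix j assume j: "0 \<le> j \<and> Suc j < n"
    then show "e (2 * j + 1) \<in> Z" "e (2 * j + 2) \<in> Z" by (auto simp: Z_def)
    have "l \<notin> interval_union Z" if l: "l \<in> gap j" for l
    proof -
      \<comment> \<open>Exactly the endpoints \<open>e 0\<close> to \<open>e (2 * j + 1)\<close> are
        at most \<open>l\<close>, an even number.\<close>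
      have "e i \<le> l \<longleftrightarrow> i < 2 * j + 2" if "i < 2 * n" for i
      proof
        assume "i < 2 * j + 2"
        then have "e i \<le> e (2 * j + 1)" using j n2 by (intro e_le) auto
        then show "e i \<le> l" using l by (simp add: gap_def)
      next
        assume "e i \<le> l"
        then have "e i < e (2 * j + 2)" using l by (simp add: gap_def)
        then show "i < 2 * j + 2" using e_le[of "2 * j + 2" i] that n2 by (meson not_less order_less_trans leD)
      qed
      then have "{z \<in> Z. z \<le> l} = e ` {..<2 * j + 2}" using j by (auto simp: Z_def)
      then show ?thesis using cardimg[of "2 * j + 2"] j n2 by (simp add: interval_union_def)
    qed
    then show "interval_union Z \<inter> gap j = {}" by blast
  next
    fix l show "\<kappa> l \<le> K l" using assms K_ge[of top] by (simp add: \<kappa>_def)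
  next
    fix l assume "l \<in> interval_union Z"
    then show "\<kappa> l = 0" using below by (auto simp: \<kappa>_def)
  next
    fix l assume "\<kappa> l \<noteq> 0"
    then show "l = top \<or> e (2 * n) \<le> l \<and> l < e (fresh 0)" by (simp add: \<kappa>_def split: if_splits)
  qed
qed

section \<open>Evaluation from the inside and size of the sets\<close>

text \<open>Induction on the number of operations carried out; the next operand, at position
  \<open>n - Suc k\<close>, is some \<open>Y (C k t)\<close>.\<close>

lemma nested_normal_form:
  assumes "k < n"
    and "\<And>i. n - k \<le> i \<Longrightarrow> i \<le> n \<Longrightarrow> a i \<in> A i"
    and "\<And>i. n - k \<le> i \<Longrightarrow> i < n \<Longrightarrow> f i \<in> {(+), (*)}"
  shows "\<exists>Z \<kappa>. admissible k Z \<kappa> \<and> nested f a (n - k) k = normal_form Z \<kappa>"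
  using assms
proof (induction k)
  case 0
  then have "a n \<in> A n" by simp
  then obtain t where t: "1 \<le> t" "t \<le> m"
    "a n = Y (interval_union (e ` {..<2 * n})) * ((\<Sum>l\<le>top. x l) + t * d top)"
    by (auto simp: A_def)
  from admissible_initial[OF t(1,2)] show ?case using t(3) by auto
next
  case (Suc k)
  define i where "i = n - Suc k"
  have i: "Suc i = n - k" "i < n" "n - Suc i = k" using Suc.prems(1) by (auto simp: i_def)
  have "\<exists>Z \<kappa>. admissible k Z \<kappa> \<and> nested f a (n - k) k = normal_form Z \<kappa>"
    using Suc.prems by (intro Suc.IH) auto
  then obtain Z \<kappa> where Z: "admissible k Z \<kappa>" "nested f a (Suc i) k = normal_form Z \<kappa>"
    unfolding i by blast
  have "a i \<in> A i" using Suc.prems(2)[of i] by (simp add: i_def)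
  then obtain t where t: "1 \<le> t" "t \<le> m" "a i = Y (C k t)"
    using i by (auto simp: A_def)
  have "f i = (+) \<or> f i = (*)" using Suc.prems(3)[of i] i by (auto simp: i_def)
  then show ?case
    unfolding i_def[symmetric] nested.simps Z(2) t(3)
    using normal_form_add[OF Z(1) Suc.prems(1) t(1,2)] normal_form_mult[OF Z(1) Suc.prems(1) t(1,2)]
    by metis
qed

text \<open>Each set is parametrized strictly increasingly by \<open>t\<close>: the innermost one
  because \<open>d top\<close> is positive, the others because a larger \<open>t\<close> brings in a
  further word, which is at least 2.\<close>

lemma A_pos_card:
  assumes "1 \<le> i" "i \<le> n"
  shows "A i \<subseteq> {1..}" "card (A i) = m"
proof -
  have "\<exists>g :: nat \<Rightarrow> nat. A i = g ` {1..m} \<and> (\<forall>t. 1 \<le> t \<and> t \<le> m \<longrightarrow> 0 < g t) \<and>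
      (\<forall>t t'. 1 \<le> t \<and> t < t' \<and> t' \<le> m \<longrightarrow> g t < g t')"
  proof (cases "i = n")
    case True
    have adm: "admissible 0 (e ` {..<2 * n}) (\<lambda>l. if l = top then t else 0)" if "1 \<le> t" "t \<le> m" for t
      by (rule admissible_initial(1)[OF that])
    show ?thesis
    proof (intro exI conjI allI impI)
      show "A i = (\<lambda>t. Y (interval_union (e ` {..<2 * n})) * ((\<Sum>l\<le>top. x l) + t * d top)) ` {1..m}"
        using True by (simp add: A_def)
    next
      fix t assume t: "1 \<le> t \<and> t \<le> m"
      then have "0 < Y (interval_union (e ` {..<2 * n}))"
        using admissible_interval_union(3)[OF adm] n by (intro Y_pos) fastforce
      then show "0 < Y (interval_union (e ` {..<2 * n})) * ((\<Sum>l\<le>top. x l) + t * d top)"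
        using d_pos[of top] t by simp
    next
      fix t t' assume t: "1 \<le> t \<and> t < t' \<and> t' \<le> m"
      then have "0 < Y (interval_union (e ` {..<2 * n}))"
        using admissible_interval_union(3)[OF adm, of t] n by (intro Y_pos) fastforce
      then show "Y (interval_union (e ` {..<2 * n})) * ((\<Sum>l\<le>top. x l) + t * d top)
          < Y (interval_union (e ` {..<2 * n})) * ((\<Sum>l\<le>top. x l) + t' * d top)"
        using d_pos[of top] t by simp
    qed
  next
    case False
    define k where "k = n - Suc i"
    have k: "Suc k < n" using False assms by (simp add: k_def)
    have top: "e (fresh k + t) \<le> top" "fresh k + t < fresh n" if "t \<le> m" for t
      using fresh_add_less(2)[OF _ that, of k] k by (auto intro: e_le_top)
    have Ctop: "C k t \<subseteq> {..top}" if "t \<le> m" for t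
    proof -
      have "gap k \<subseteq> {..top}"
        using gap_less[OF k] e_le_top[of "2 * n"] top(2)[of 0] twice_n_le_fresh[of k] by fastforce
      then show ?thesis using top[OF that] by (auto simp: C_def)
    qed
    show ?thesis
    proof (intro exI conjI allI impI)
      show "A i = (\<lambda>t. Y (C k t)) ` {1..m}" using False by (simp add: A_def k_def)
    next
      fix t assume "1 \<le> t \<and> t \<le> m"
      then show "0 < Y (C k t)" using Ctop by (intro Y_pos) auto
    next
      fix t t' assume t: "1 \<le> t \<and> t < t' \<and> t' \<le> m"
      define w where "w = e (fresh k + t)"
      have w: "w < e (fresh k + t')" "e (fresh k) \<le> w" "e (2 * n) \<le> e (fresh k)"
        using t top(2)[of t'] top(2)[of t] twice_n_le_fresh[of k] by (auto simp: w_def intro!: e_less e_le)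
      have fin: "finite (C k t')" by (simp add: C_def gap_def)
      have "w \<notin> C k t" using gap_less[OF k, of w] w by (auto simp: C_def w_def)
      moreover have sub: "insert w (C k t) \<subseteq> C k t'" using w by (auto simp: C_def w_def)
      moreover have "finite (C k t)" by (simp add: C_def gap_def)
      ultimately have eq: "Y (insert w (C k t)) = Q w * d w * Y (C k t)" by (simp add: Y_def)
      have "w \<le> top" using w(1) top(1)[of t'] t by simp
      then have "2 * 1 \<le> Q w * d w" using Q_ge[of w] d_pos[of w] by (intro mult_le_mono) auto
      moreover have "0 < Y (C k t)" using Ctop[of t] t by (intro Y_pos) auto
      ultimately have "Y (C k t) < Y (insert w (C k t))" unfolding eq by simp
      also have "\<dots> \<le> Y (C k t')"
      proof (rule dvd_imp_le)
        show "Y (insert w (C k t)) dvd Y (C k t')"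
          unfolding Y_def using fin sub by (rule prod_dvd_prod_subset)
        show "0 < Y (C k t')" using Ctop[of t'] t by (intro Y_pos) auto
      qed
      finally show "Y (C k t) < Y (C k t')" .
    qed
  qed
  then obtain g :: "nat \<Rightarrow> nat" where g: "A i = g ` {1..m}" "\<And>t. 1 \<le> t \<Longrightarrow> t \<le> m \<Longrightarrow> 0 < g t"
    "\<And>t t'. 1 \<le> t \<Longrightarrow> t < t' \<Longrightarrow> t' \<le> m \<Longrightarrow> g t < g t'" by auto
  then show "A i \<subseteq> {1..}" by (auto simp: Suc_le_eq)
  have "inj_on g {1..m}"
    by (rule linorder_inj_onI) (use g(3) in \<open>force+\<close>)
  then show "card (A i) = m" using g(1) by (simp add: card_image)
qed

end

section \<open>Combination of the progressions with Ramsey's theorem\<close>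

theorem corollary1p4:
  fixes n m :: nat and c :: "nat \<Rightarrow> 'c"
  assumes "n \<ge> 1" and "m \<ge> 1"
    and "finite_coloring c"
  shows "\<exists>A :: nat \<Rightarrow> nat set.
           (\<forall>i\<in>{1..n}. A i \<subseteq> {1..} \<and> card (A i) = m) \<and>
           monochromatic c (nested_values n A)"
proof -
  \<comment> \<open>The hypothesis covers positive integers only; 0 contributes at most one more
    color.\<close>
  have "(UNIV :: nat set) = insert 0 {1..}" by (auto simp: Suc_le_eq)
  then have "range c = insert (c 0) (c ` {1..})" by (metis image_insert)
  then have fin: "finite (range c)" using assms(3) by (simp add: finite_coloring_def)
  define M where "M = 2 * n + n * Suc m"
  obtain N where N: "\<And>f :: nat set \<Rightarrow> nat. (\<And>Z. f Z < card (range c)) \<Longrightarrow>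
     \<exists>e :: nat \<Rightarrow> nat. strict_mono_on {..<M} e \<and> (\<forall>i<M. e i < N) \<and>
        (\<exists>\<gamma>. \<forall>Z\<subseteq>e ` {..<M}. card Z = 2 * n \<longrightarrow> f Z = \<gamma>)"
    using Ramsey_enumerated[of "card (range c)" M "2 * n"] by metis
  show ?thesis
  \<comment> \<open>One index more than Ramsey's theorem uses: \<open>N\<close> itself becomes
    \<open>top\<close>.\<close>
  proof (rule generic_progressions[OF fin, of "Suc N" m])
    fix x d Q K :: "nat \<Rightarrow> nat"
    assume gp: "\<And>l. l < Suc N \<Longrightarrow> 0 < d l" "\<And>l. 2 \<le> Q l" "\<And>l. m \<le> K l"
      "\<And>l U. l < Suc N \<Longrightarrow> U \<subseteq> {..<l} \<Longrightarrow> (\<Prod>i\<in>U. Q i * d i) dvd Q l"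
      "\<And>l U. l < Suc N \<Longrightarrow> U \<subseteq> {..<l} \<Longrightarrow> Q l * (\<Prod>i\<in>U. Q i * d i) \<le> K l"
      "\<And>U \<kappa>. U \<subseteq> {..<Suc N} \<Longrightarrow> (\<And>l. l < Suc N \<Longrightarrow> \<kappa> l \<le> K l) \<Longrightarrow> (\<And>l. l \<in> U \<Longrightarrow> \<kappa> l = 0) \<Longrightarrow>
         c ((\<Prod>i\<in>U. Q i * d i) * (\<Sum>l<Suc N. x l + \<kappa> l * d l)) = c ((\<Prod>i\<in>U. Q i * d i) * (\<Sum>l<Suc N. x l))"
    \<comment> \<open>This is the color of \<open>q x\<close> as a function of the endpoint set, to
      which Ramsey's theorem applies.\<close>
    define color where "color Z = c ((\<Prod>i\<in>interval_union Z. Q i * d i) * (\<Sum>l<Suc N. x l))" for Z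
    obtain code :: "'c \<Rightarrow> nat" where code: "\<And>y. y \<in> range c \<Longrightarrow> code y < card (range c)"
      "\<And>y z. y \<in> range c \<Longrightarrow> z \<in> range c \<Longrightarrow> code y = code z \<longleftrightarrow> y = z"
      using finite_image_code[of id "range c" "card (range c)"] fin by auto
    have "code (color Z) < card (range c)" for Z by (simp add: code(1) color_def)
    from N[of "\<lambda>Z. code (color Z)", OF this] obtain e :: "nat \<Rightarrow> nat" and \<gamma> where e: "strict_mono_on {..<M} e" "\<forall>i<M. e i < N"
      and \<gamma>: "\<forall>Z\<subseteq>e ` {..<M}. card Z = 2 * n \<longrightarrow> code (color Z) = \<gamma>"
      by blast
    interpret generic_words n m N x d Q K e
    proof
      show "strict_mono_on {..<2 * n + n * Suc m} e" using e(1) by (simp add: M_def)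
      show "e i \<le> N" if "i < 2 * n + n * Suc m" for i using e(2) that by (simp add: M_def less_imp_le)
    qed (use assms(1) gp(1-5) in \<open>simp_all add: less_Suc_eq_le\<close>)
    have color: "v \<in> range c \<and> code v = \<gamma>" if v: "v \<in> c ` nested_values n A" for v
    proof -
      obtain f a where fa: "v = c (nested f a 1 (n - 1))" "\<forall>i\<in>{1..n}. a i \<in> A i"
        "\<forall>i\<in>{1..n - 1}. f i \<in> {(+), (*)}"
        using v unfolding nested_values_def by blast
      have "\<exists>Z \<kappa>. admissible (n - 1) Z \<kappa> \<and> nested f a (n - (n - 1)) (n - 1) = normal_form Z \<kappa>"
      proof (rule nested_normal_form)
        show "n - 1 < n" using assms(1) by simp
        show "a i \<in> A i" if "n - (n - 1) \<le> i" "i \<le> n" for i using that assms(1) by (intro bspec[OF fa(2)]) simp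
        show "f i \<in> {(+), (*)}" if "n - (n - 1) \<le> i" "i < n" for i
          using that assms(1) by (intro bspec[OF fa(3)]) simp
      qed
      then obtain Z \<kappa> where Z: "admissible (n - 1) Z \<kappa>" "nested f a 1 (n - 1) = normal_form Z \<kappa>"
        using assms(1) by auto
      have below: "interval_union Z \<subseteq> {..<N}" using admissible_interval_union(3)[OF Z(1)] assms(1) by simp
      \<comment> \<open>Admissible shifts are bounded by \<open>K\<close> and vanish on the indices
        of \<open>q\<close>, so they do not change the color.\<close>
      have "c (normal_form Z \<kappa>) = color Z"
        unfolding normal_form_def color_def Y_def lessThan_Suc_atMost[symmetric]
        using Z(1) below by (intro gp(6)) (auto simp: admissible_def)
      moreover have "Z \<subseteq> e ` {..<M}"
      proof -
        have "fresh (n - 1) \<le> M" using fresh_mono[of "n - 1" n] by (simp add: fresh_def M_def)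
        then show ?thesis using Z(1) by (fastforce simp: admissible_def)
      qed
      ultimately show ?thesis
        using \<gamma> Z fa(1) by (auto simp: admissible_def color_def)
    qed
    have "monochromatic c (nested_values n A)"
      unfolding monochromatic_def using color code(2) by (metis imageI)
    then show ?thesis
      using A_pos_card by (intro exI[of _ A]) auto
  qed
qed

end
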